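(* Let $\mathcal{F}$ denote the class of countable forests, and let $\mathcal{F}_{\mathrm{E}}$ denote the class of countable graphs $G$ such that removing some finite set of edges from $G$ yields a forest. Then $$\mathcal{F}_{\mathrm{E}}=\mathrm{Forb}\left(\omega\cdot K_3,\ \bigvee K_3,\ K_{2,\omega}\right).$$
   Context: All graphs are countable and simple. A graph $H$ is a minor of $G$ if there are pairwise disjoint non-empty connected subgraphs $B_v$ ($v\in V(H)$) of $G$ (branch sets, possibly infinite) and for each $uv\in E(H)$ an edge of $G$ between $B_u$ and $B_v$. For a set $X$ of graphs, $\mathrm{Forb}(X)$ is the class of (countable) graphs $H$ such that no element of $X$ is a minor of $H$. $\omega\cdot K_3$ is the disjoint union of countably infinitely many triangles; $\bigvee K_3$ is the graph obtained from $\omega\cdot K_3$ by picking one vertex from each copy of $K_3$ and identifying all of them; $K_{2,\omega}$ is the complete bipartite graph with sides of size $2$ and $\aleph_0$. *)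

theory Defs
  imports "HOL-Library.Countable_Set"
begin

datatype 'a graph = Graph (verts: "'a set") (edges: "'a set set")

definition simple_graph :: "'a graph \<Rightarrow> bool" where
  "simple_graph G \<longleftrightarrow> (\<forall>e\<in>edges G. e \<subseteq> verts G \<and> card e = 2)"

text \<open>As everywhere in the library, \<open>countable\<close> includes the finite case.\<close>

definition countable_graphs :: "'a graph set" where
  "countable_graphs = {G. simple_graph G \<and> countable (verts G)}"

definition adj :: "'a graph \<Rightarrow> 'a \<Rightarrow> 'a \<Rightarrow> bool" where
  "adj G u v \<longleftrightarrow> {u, v} \<in> edges G"

definition subgraph :: "'a graph \<Rightarrow> 'a graph \<Rightarrow> bool" where
  "subgraph H G \<longleftrightarrow> simple_graph H \<and> verts H \<subseteq> verts G \<and> edges H \<subseteq> edges G"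

text \<open>The empty graph is connected in this sense; non-emptiness of branch sets is required
  separately in \<open>is_minor\<close>.\<close>

definition connected_graph :: "'a graph \<Rightarrow> bool" where
  "connected_graph G \<longleftrightarrow> (\<forall>u\<in>verts G. \<forall>v\<in>verts G. (adj G)\<^sup>*\<^sup>* u v)"

definition is_minor :: "'b graph \<Rightarrow> 'a graph \<Rightarrow> bool" where
  "is_minor H G \<longleftrightarrow> (\<exists>B :: 'b \<Rightarrow> 'a graph.
     (\<forall>v\<in>verts H. subgraph (B v) G \<and> connected_graph (B v) \<and> verts (B v) \<noteq> {}) \<and>
     (\<forall>u\<in>verts H. \<forall>v\<in>verts H. u \<noteq> v \<longrightarrow> verts (B u) \<inter> verts (B v) = {}) \<and>
     (\<forall>u v. {u, v} \<in> edges H \<longrightarrow> (\<exists>x\<in>verts (B u). \<exists>y\<in>verts (B v). {x, y} \<in> edges G)))"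

text \<open>The vertex type of the excluded graphs may differ from that of the members of the class.\<close>

definition Forb :: "'b graph set \<Rightarrow> 'a graph set" where
  "Forb X = {G \<in> countable_graphs. \<forall>H\<in>X. \<not> is_minor H G}"

definition is_cycle :: "'a graph \<Rightarrow> 'a list \<Rightarrow> bool" where
  "is_cycle G c \<longleftrightarrow> 3 \<le> length c \<and> distinct c \<and>
     (\<forall>i<length c. adj G (c ! i) (c ! (Suc i mod length c)))"

definition forests :: "'a graph set" where
  "forests = {G \<in> countable_graphs. \<nexists>c. is_cycle G c}"

definition remove_edges :: "'a graph \<Rightarrow> 'a set set \<Rightarrow> 'a graph" where
  "remove_edges G F = Graph (verts G) (edges G - F)"

definition forests_E :: "'a graph set" where
  "forests_E = {G \<in> countable_graphs.
     \<exists>F. F \<subseteq> edges G \<and> finite F \<and> remove_edges G F \<in> forests}"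

definition complete_graph :: "'a set \<Rightarrow> 'a graph" where
  "complete_graph V = Graph V {e. e \<subseteq> V \<and> card e = 2}"

text \<open>The two sides are meant to be disjoint.\<close>

definition complete_bipartite :: "'a set \<Rightarrow> 'a set \<Rightarrow> 'a graph" where
  "complete_bipartite A B = Graph (A \<union> B) {{a, b} |a b. a \<in> A \<and> b \<in> B}"

definition omega_copies :: "'a graph \<Rightarrow> (nat \<times> 'a) graph" where
  "omega_copies G = Graph (UNIV \<times> verts G) {Pair n ` e |n e. e \<in> edges G}"

text \<open>Identify all vertices in \<open>S\<close> with the representative \<open>s \<in> S\<close>; loops and parallel edges
  that may arise are discarded.\<close>

definition identify :: "'a set \<Rightarrow> 'a \<Rightarrow> 'a graph \<Rightarrow> 'a graph" where
  "identify S s G = (let f = (\<lambda>v. if v \<in> S then s else v) in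
     Graph (f ` verts G) {{f u, f v} |u v. {u, v} \<in> edges G \<and> f u \<noteq> f v})"

definition K3 :: "nat graph" where
  "K3 = complete_graph {0, 1, 2}"

definition omega_K3 :: "(nat \<times> nat) graph" where
  "omega_K3 = omega_copies K3"

definition wedge_K3 :: "(nat \<times> nat) graph" where
  "wedge_K3 = identify (UNIV \<times> {0}) (0, 0) omega_K3"

text \<open>The sides are \<open>{(0, 0), (0, 1)}\<close> and \<open>{(1, n) | n. True}\<close>, placed in
  \<^typ>\<open>nat \<times> nat\<close> so that the three excluded graphs share a vertex type.\<close>

definition K2_omega :: "(nat \<times> nat) graph" where
  "K2_omega = complete_bipartite ({0} \<times> {0, 1}) ({1} \<times> UNIV)"

lemma K3_in_countable_graphs: "K3 \<in> countable_graphs"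
  by (auto simp: K3_def complete_graph_def countable_graphs_def simple_graph_def)

lemma omega_K3_in_countable_graphs: "omega_K3 \<in> countable_graphs"
  by (auto simp: omega_K3_def omega_copies_def K3_def complete_graph_def countable_graphs_def
      simple_graph_def card_image inj_on_def)

lemma wedge_K3_in_countable_graphs: "wedge_K3 \<in> countable_graphs"
proof -
  define f where "f = (\<lambda>v :: nat \<times> nat. if v \<in> UNIV \<times> {0} then (0, 0) else v)"
  have W: "wedge_K3 = Graph (f ` verts omega_K3)
      {{f u, f v} |u v. {u, v} \<in> edges omega_K3 \<and> f u \<noteq> f v}"
    unfolding wedge_K3_def identify_def Let_def f_def ..
  have sub: "u \<in> verts omega_K3 \<and> v \<in> verts omega_K3" if "{u, v} \<in> edges omega_K3" for u v
    using omega_K3_in_countable_graphs that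
    unfolding countable_graphs_def simple_graph_def by blast
  have "e \<subseteq> f ` verts omega_K3 \<and> card e = 2" if "e \<in> edges wedge_K3" for e
  proof -
    from that obtain u v where "e = {f u, f v}" "{u, v} \<in> edges omega_K3" "f u \<noteq> f v"
      unfolding W by auto
    with sub[of u v] show ?thesis by simp
  qed
  then show ?thesis
    by (simp add: countable_graphs_def simple_graph_def W)
qed

lemma K2_omega_in_countable_graphs: "K2_omega \<in> countable_graphs"
  by (auto simp: K2_omega_def complete_bipartite_def countable_graphs_def simple_graph_def)

end

theory Submission imports Defs begin

text \<open>
  A graph that is a forest up to \<open>k\<close> edges has, in every non-empty finite subgraph, fewer edges
  than vertices plus \<open>k\<close>, because a non-empty finite graph with at least as many edges as vertices
  contains a cycle (\<open>many_edges_has_cycle\<close>). The difference between the numbers of edges and vertices of a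
  finite graph does not drop when passing from a minor to a suitable finite subgraph realizing it
  (\<open>minor_model_excess\<close>). In \<open>\<Or>K\<^sub>3\<close> and \<open>K\<^sub>2\<^sub>,\<^sub>\<omega>\<close> this difference is unbounded, so they are not
  minors. In a model of \<open>\<omega>\<cdot>K\<^sub>3\<close> each triangle yields a cycle, and these cycles are disjoint, so
  finitely many edges cannot meet all of them.

  Conversely, suppose that \<open>G\<close> has none of the three minors. For any kind of finite vertex set there
  are either infinitely many disjoint sets of this kind or a finite set meeting all of them
  (\<open>infinite_disjoint_sequence\<close>). This is used twice. For vertex sets of cycles, infinitely
  many would give \<open>\<omega>\<cdot>K\<^sub>3\<close>, so some finite \<open>X\<close> meets every cycle. For connected sets with two
  neighbours of a fixed vertex \<open>x \<in> X\<close>, infinitely many would give \<open>\<Or>K\<^sub>3\<close>, so a finite set meets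
  them all. The union \<open>U\<close> of these finite sets has the property that each of its vertices sends at most
  one edge to each component of \<open>G - U\<close> (\<open>finite_separator\<close>); for vertices of \<open>U\<close> outside \<open>X\<close> this
  holds because \<open>G - X\<close> is a forest. Two vertices of \<open>U\<close> have only
  finitely many components of \<open>G - U\<close> as common neighbours, since infinitely many would give
  \<open>K\<^sub>2\<^sub>,\<^sub>\<omega>\<close>. Hence only finitely many edges lie inside \<open>U\<close> or lead from \<open>U\<close> to a component with at
  least two neighbours in \<open>U\<close>. Without them every component has at most one edge to \<open>U\<close>. Every
  cycle meets \<open>U\<close> and also leaves it, and so would need two edges between a component and \<open>U\<close>;
  thus the remaining graph is a forest.
\<close>

section \<open>Basic facts on adjacency and connected vertex sets\<close>

definition induced :: "'a graph \<Rightarrow> 'a set \<Rightarrow> 'a graph" where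
  "induced G S = Graph S {e \<in> edges G. e \<subseteq> S}"

definition conn :: "'a graph \<Rightarrow> 'a set \<Rightarrow> bool" where
  "conn G S \<longleftrightarrow> connected_graph (induced G S)"

lemma adj_sym: "adj G u v \<Longrightarrow> adj G v u"
  by (simp add: adj_def insert_commute)

lemma adj_simple:
  assumes "simple_graph G" "adj G u v"
  shows "u \<noteq> v" "u \<in> verts G" "v \<in> verts G"
  using assms by (auto simp: simple_graph_def adj_def card_2_iff doubleton_eq_iff)

lemma adj_rtranclp_sym: "(adj G)\<^sup>*\<^sup>* u v \<Longrightarrow> (adj G)\<^sup>*\<^sup>* v u"
  by (induction rule: rtranclp_induct) (auto intro: converse_rtranclp_into_rtranclp adj_sym)

lemma adj_induced: "adj (induced G S) u v \<longleftrightarrow> adj G u v \<and> u \<in> S \<and> v \<in> S"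
  by (auto simp: adj_def induced_def)

lemma verts_induced [simp]: "verts (induced G S) = S"
  by (simp add: induced_def)

lemma connected_graph_mono:
  assumes "connected_graph (Graph S E)" "E \<subseteq> edges G" "E \<subseteq> Pow S"
  shows "conn G S"
proof -
  have "adj (Graph S E) \<le> adj (induced G S)"
    using assms(2,3) by (auto simp: adj_def induced_def subset_iff)
  then have "(adj (Graph S E))\<^sup>*\<^sup>* \<le> (adj (induced G S))\<^sup>*\<^sup>*" by (rule rtranclp_mono)
  then show ?thesis using assms(1) by (auto simp: conn_def connected_graph_def le_fun_def)
qed

lemma connected_graphI:
  assumes "\<And>v. v \<in> verts G \<Longrightarrow> (adj G)\<^sup>*\<^sup>* r v"
  shows "connected_graph G"
  unfolding connected_graph_def
  by (meson adj_rtranclp_sym assms rtranclp_trans)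

lemma conn_singleton: "conn G {a}"
  by (simp add: conn_def connected_graph_def)

lemma connected_graph_insert:
  assumes "connected_graph (Graph S E)" "z \<in> S"
  shows "connected_graph (Graph (insert w S) (insert {z, w} E))"
proof (rule connected_graphI)
  fix v assume v: "v \<in> verts (Graph (insert w S) (insert {z, w} E))"
  let ?G = "Graph (insert w S) (insert {z, w} E)"
  have "adj (Graph S E) \<le> adj ?G" by (auto simp: adj_def)
  then have mono: "(adj (Graph S E))\<^sup>*\<^sup>* \<le> (adj ?G)\<^sup>*\<^sup>*" by (rule rtranclp_mono)
  show "(adj ?G)\<^sup>*\<^sup>* z v"
  proof (cases "v = w")
    case True
    then show ?thesis by (auto simp: adj_def)
  next
    case False
    with v have "(adj (Graph S E))\<^sup>*\<^sup>* z v" using assms by (auto simp: connected_graph_def)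
    with mono show ?thesis by auto
  qed
qed

lemma conn_insert:
  assumes "conn G S" "z \<in> S" "adj G z w"
  shows "conn G (insert w S)"
proof -
  have "connected_graph (Graph (insert w S) (insert {z, w} {e \<in> edges G. e \<subseteq> S}))"
    using assms connected_graph_insert unfolding conn_def induced_def by metis
  then show ?thesis
    by (rule connected_graph_mono) (use assms in \<open>auto simp: adj_def\<close>)
qed

lemma conn_path:
  assumes "p \<noteq> []" "\<And>i. Suc i < length p \<Longrightarrow> adj G (p ! i) (p ! Suc i)"
  shows "conn G (set p)"
  using assms
proof (induction p)
  case (Cons a p)
  show ?case
  proof (cases "p = []")
    case True
    then show ?thesis by (simp add: conn_singleton)
  next
    case False
    have "conn G (set p)" using Cons.IH[OF False] Cons.prems(2)[of "Suc _"] by simp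
    moreover have "adj G (p ! 0) a" using Cons.prems(2)[of 0] False by (simp add: adj_sym)
    moreover have "p ! 0 \<in> set p" using False by simp
    ultimately show ?thesis by (simp add: conn_insert)
  qed
qed simp

definition component :: "'a graph \<Rightarrow> 'a set \<Rightarrow> 'a \<Rightarrow> 'a set" where
  "component G W a = {b. (adj (induced G W))\<^sup>*\<^sup>* a b}"

lemma component_self: "a \<in> component G W a"
  by (simp add: component_def)

lemma component_subset:
  assumes "a \<in> W" shows "component G W a \<subseteq> W"
proof
  fix b assume "b \<in> component G W a"
  then have "(adj (induced G W))\<^sup>*\<^sup>* a b" by (simp add: component_def)
  then show "b \<in> W" using assms by (cases rule: rtranclp.cases) (auto simp: adj_induced)
qed

lemma component_closed:
  assumes "b \<in> component G W a" "adj G b c" "b \<in> W" "c \<in> W"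
  shows "c \<in> component G W a"
  using assms unfolding component_def by (auto simp: adj_induced intro: rtranclp.rtrancl_into_rtrancl)

lemma component_eq:
  assumes "c \<in> component G W a" "c \<in> component G W b"
  shows "component G W a = component G W b"
  using assms unfolding component_def
  by (auto; meson adj_rtranclp_sym rtranclp_trans)

lemma conn_component: "conn G (component G W a)"
  unfolding conn_def
proof (rule connected_graphI)
  fix v assume "v \<in> verts (induced G (component G W a))"
  then have "(adj (induced G W))\<^sup>*\<^sup>* a v" by (simp add: component_def)
  then show "(adj (induced G (component G W a)))\<^sup>*\<^sup>* a v"
  proof (induction rule: rtranclp_induct)
    case (step y z)
    then have "y \<in> component G W a" "z \<in> component G W a" by (auto simp: component_def)
    with step show ?case
      by (meson adj_induced rtranclp.rtrancl_into_rtrancl)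
  qed simp
qed

text \<open>Joining the required vertices one at a time, along walks from a root, adds an edge with
  every new vertex. The edge count feeds the cycle bound; connectedness turns branch sets
  and components, which may be infinite, into finite connected sets.\<close>

lemma finite_connected_subgraph:
  assumes B: "connected_graph B" and R: "finite R" "R \<subseteq> verts B" and r: "r \<in> verts B"
    and simple: "simple_graph B"
  obtains V E where "finite V" "insert r R \<subseteq> V" "V \<subseteq> verts B" "E \<subseteq> edges B" "E \<subseteq> Pow V"
    "connected_graph (Graph V E)" "card V \<le> card E + 1"
proof -
  define good where "good = (\<lambda>V E. finite V \<and> r \<in> V \<and> V \<subseteq> verts B \<and> E \<subseteq> edges B \<and> E \<subseteq> Pow V \<and>
    connected_graph (Graph V E) \<and> card V \<le> card E + 1)"
  have extend: "\<exists>V' E'. good V' E' \<and> V \<subseteq> V' \<and> w \<in> V'"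
    if "(adj B)\<^sup>*\<^sup>* r w" "good V E" for w V E
    using that
  proof (induction rule: rtranclp_induct)
    case base
    then show ?case by (auto simp: good_def)
  next
    case (step y z)
    then obtain V' E' where g: "good V' E'" "V \<subseteq> V'" "y \<in> V'" by blast
    show ?case
    proof (cases "z \<in> V'")
      case True
      with g show ?thesis by blast
    next
      case False
      \<comment> \<open>The edge to a new vertex cannot have been present already.\<close>
      have new: "{y, z} \<notin> E'" using False g(1) by (auto simp: good_def)
      have fin: "finite V'" "finite E'" using g(1) by (auto simp: good_def intro: finite_subset)
      have "connected_graph (Graph (insert z V') (insert {y, z} E'))"
        using g by (intro connected_graph_insert) (auto simp: good_def)
      moreover have "z \<in> verts B" using step adj_simple[OF simple] by blast
      ultimately have "good (insert z V') (insert {y, z} E')"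
        using g fin new False step(2) by (auto simp: good_def adj_def)
      with g show ?thesis by blast
    qed
  qed
  have "\<exists>V E. good V E \<and> R \<subseteq> V"
    using R
  proof (induction rule: finite_induct)
    case empty
    have "good {r} {}" using r by (simp add: good_def connected_graph_def)
    then show ?case by blast
  next
    case (insert w R)
    then obtain V E where g: "good V E" "R \<subseteq> V" by auto
    have "(adj B)\<^sup>*\<^sup>* r w" using B r insert.prems by (auto simp: connected_graph_def)
    from extend[OF this g(1)] g(2) show ?case by blast
  qed
  then show ?thesis using that by (auto simp: good_def)
qed

section \<open>Cycles\<close>

lemma is_cycle_mono: "is_cycle G c \<Longrightarrow> edges G \<subseteq> edges H \<Longrightarrow> is_cycle H c"
  by (auto simp: is_cycle_def adj_def)

text \<open>An end of a longest path has all its neighbours on the path; the one that is not its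
  successor closes a cycle.\<close>

lemma min_degree_two_has_cycle:
  assumes fin: "finite V" and ne: "V \<noteq> {}" and simple: "simple_graph (Graph V E)"
    and deg: "\<And>v w. v \<in> V \<Longrightarrow> \<exists>z. z \<noteq> w \<and> adj (Graph V E) v z"
  shows "\<exists>c. is_cycle (Graph V E) c"
proof -
  let ?G = "Graph V E"
  define path where "path = (\<lambda>p. p \<noteq> [] \<and> distinct p \<and> set p \<subseteq> V \<and>
    (\<forall>i. Suc i < length p \<longrightarrow> adj ?G (p ! i) (p ! Suc i)))"
  obtain v where "v \<in> V" using ne by blast
  then have "path [v]" by (simp add: path_def)
  moreover have "length p < Suc (card V)" if "path p" for p
    using that card_mono[OF fin, of "set p"] by (simp add: path_def distinct_card less_Suc_eq_le)
  ultimately obtain p where p: "path p" and max: "\<And>q. path q \<Longrightarrow> length q \<le> length p"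
    using ex_has_greatest_nat[of path "[v]" length "Suc (card V)"] by (metis less_imp_le)
  have p0: "p \<noteq> []" "p ! 0 \<in> V" using p by (auto simp: path_def)
  obtain z where z: "adj ?G (p ! 0) z" "z \<noteq> p ! 1" using deg[OF p0(2)] by blast
  have zV: "z \<in> V" "z \<noteq> p ! 0" using adj_simple[OF simple z(1)] by auto
  have "z \<in> set p"
  proof (rule ccontr)
    assume "z \<notin> set p"
    then have "path (z # p)"
      using p zV adj_sym[OF z(1)] by (auto simp: path_def nth_Cons split: nat.splits)
    from max[OF this] show False by simp
  qed
  then obtain j where j: "j < length p" "p ! j = z" by (auto simp: in_set_conv_nth)
  have j2: "2 \<le> j"
  proof (rule ccontr)
    assume "\<not> 2 \<le> j"
    then have "j = 0 \<or> j = 1" by linarith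
    then show False using j zV z by auto
  qed
  have "is_cycle ?G (take (Suc j) p)"
    unfolding is_cycle_def
  proof (intro conjI allI impI)
    show "3 \<le> length (take (Suc j) p)" using j j2 by simp
    show "distinct (take (Suc j) p)" using p by (simp add: path_def)
    fix i assume i: "i < length (take (Suc j) p)"
    then have "i < j \<or> i = j" using j by auto
    then show "adj ?G (take (Suc j) p ! i) (take (Suc j) p ! (Suc i mod length (take (Suc j) p)))"
    proof
      assume "i < j"
      then show ?thesis using j p by (simp add: path_def min_def)
    next
      assume "i = j"
      moreover have "length (take (Suc j) p) = Suc j" using j by simp
      ultimately show ?thesis using j p0(1) adj_sym[OF z(1)] by simp
    qed
  qed
  then show ?thesis by blast
qed

text \<open>Deleting a vertex of degree at most one keeps the inequality, so a minimal instance has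
  minimum degree at least two.\<close>

lemma many_edges_has_cycle:
  assumes "finite V" "V \<noteq> {}" "simple_graph (Graph V E)" "card V \<le> card E"
  shows "\<exists>c. is_cycle (Graph V E) c"
  using assms
proof (induction "card V" arbitrary: V E rule: less_induct)
  case less
  let ?G = "Graph V E"
  have finE: "finite E"
    using less.prems by (auto simp: simple_graph_def intro: finite_subset[of _ "Pow V"])
  show ?case
  proof (cases "\<forall>v\<in>V. \<forall>w. \<exists>z. z \<noteq> w \<and> adj ?G v z")
    case True
    then show ?thesis using less.prems min_degree_two_has_cycle[of V E] by blast
  next
    case False
    then obtain v w where v: "v \<in> V" and w: "\<And>z. adj ?G v z \<Longrightarrow> z = w" by blast
    let ?E = "E - {{v, w}}" and ?V = "V - {v}"
    have away: "v \<notin> e" if "e \<in> ?E" for e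
    proof
      assume "v \<in> e"
      from that have "card e = 2" using less.prems(3) by (auto simp: simple_graph_def)
      then obtain z where "e = {v, z}" using \<open>v \<in> e\<close> by (auto simp: card_2_iff insert_commute)
      with w[of z] that show False by (auto simp: adj_def)
    qed
    have "E \<noteq> {}" using less.prems by auto
    then obtain a b where ab: "a \<in> V" "b \<in> V" "a \<noteq> b"
      using less.prems(3) by (fastforce simp: simple_graph_def card_2_iff)
    have "\<exists>c. is_cycle (Graph ?V ?E) c"
    proof (rule less.hyps)
      show "card ?V < card V" using v less.prems(1) by (meson card_Diff1_less)
      show "finite ?V" using less.prems(1) by simp
      show "?V \<noteq> {}" using ab by auto
      show "simple_graph (Graph ?V ?E)"
        using less.prems(3) away by (auto simp: simple_graph_def)
      have "card E \<le> card ?E + 1" using finE by (cases "{v, w} \<in> E") (simp_all add: card_Diff_singleton)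
      then show "card ?V \<le> card ?E" using less.prems v by (simp add: card_Diff_singleton)
    qed
    then show ?thesis using is_cycle_mono[of "Graph ?V ?E" _ ?G] by auto
  qed
qed

text \<open>Going round, a cycle enters a set as well as leaves it, and because it is longer than two it
  does so along different edges.\<close>

lemma cycle_crosses_twice:
  assumes c: "is_cycle G c" and a: "a \<in> set c" "a \<in> D" and b: "b \<in> set c" "b \<notin> D"
  obtains p q p' q' where "adj G p q" "adj G p' q'" "{p, q} \<noteq> {p', q'}"
    "p \<in> D" "q \<notin> D" "p' \<in> D" "q' \<notin> D"
proof -
  let ?n = "length c" and ?s = "\<lambda>i. Suc i mod length c"
  have n: "3 \<le> ?n" "distinct c" and e: "\<And>i. i < ?n \<Longrightarrow> adj G (c ! i) (c ! ?s i)"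
    using c by (auto simp: is_cycle_def)
  obtain i0 where i0: "i0 < ?n" "c ! i0 = a" using a(1) by (auto simp: in_set_conv_nth)
  obtain j0 where j0: "j0 < ?n" "c ! j0 = b" using b(1) by (auto simp: in_set_conv_nth)
  \<comment> \<open>A property that never gets lost along the cycle holds everywhere once it holds somewhere.\<close>
  have round: "Q (c ! k)"
    if "i < ?n" "Q (c ! i)" "\<And>i. i < ?n \<Longrightarrow> Q (c ! i) \<Longrightarrow> Q (c ! ?s i)" "k < ?n" for Q i k
  proof -
    have "Q (c ! ((i + m) mod ?n))" for m
    proof (induction m)
      case 0
      then show ?case using that by simp
    next
      case (Suc m)
      have "?n > 0" using that by auto
      then show ?case using that(3)[OF _ Suc] by (simp add: mod_Suc_eq)
    qed
    from this[of "?n + k - i"] show ?thesis using that by simp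
  qed
  obtain i where i: "i < ?n" "c ! i \<in> D" "c ! ?s i \<notin> D"
    using round[of i0 "\<lambda>x. x \<in> D" j0] i0 j0 a b by blast
  obtain j where j: "j < ?n" "c ! j \<notin> D" "c ! ?s j \<in> D"
    using round[of j0 "\<lambda>x. x \<notin> D" i0] i0 j0 a b by blast
  have "{c ! i, c ! ?s i} \<noteq> {c ! ?s j, c ! j}"
  proof
    assume "{c ! i, c ! ?s i} = {c ! ?s j, c ! j}"
    then have "c ! i = c ! ?s j" "c ! ?s i = c ! j" using i j by (auto simp: doubleton_eq_iff)
    moreover have "?s i < ?n" "?s j < ?n" using n by (auto intro: mod_less_divisor)
    ultimately have "i = ?s j" "?s i = j" using n i j by (auto simp: nth_eq_iff_index_eq)
    then show False using n i(1) j(1) by (auto simp: mod_Suc split: if_splits)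
  qed
  with that[of "c ! i" "c ! ?s i" "c ! ?s j" "c ! j"] i j e[OF i(1)] adj_sym[OF e[OF j(1)]]
  show ?thesis by blast
qed

section \<open>The three excluded graphs\<close>

lemma edges_K3: "edges K3 = {{0, 1}, {0, 2}, {1, 2}}"
proof -
  have "e \<in> {{0, 1}, {0, 2}, {1, 2}}" if "e \<subseteq> {0, 1, 2}" "card e = 2" for e :: "nat set"
    using that by (auto simp: card_2_iff)
  moreover have "e \<subseteq> {0, 1, 2} \<and> card e = 2" if "e \<in> {{0, 1}, {0, 2}, {1, 2}}" for e :: "nat set"
    using that by auto
  ultimately have "{e :: nat set. e \<subseteq> {0, 1, 2} \<and> card e = 2} = {{0, 1}, {0, 2}, {1, 2}}"
    by blast
  then show ?thesis by (simp add: K3_def complete_graph_def)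
qed

lemma verts_omega_K3: "verts omega_K3 = UNIV \<times> {0, 1, 2}"
  by (simp add: omega_K3_def omega_copies_def K3_def complete_graph_def)

lemma edges_omega_K3:
  "edges omega_K3 = (\<Union>n. {{(n, 0), (n, 1)}, {(n, 0), (n, 2)}, {(n, 1), (n, 2)}})"
proof -
  have "edges omega_K3 = (\<Union>n. (`) (Pair n) ` edges K3)"
    by (auto simp: omega_K3_def omega_copies_def)
  then show ?thesis by (simp add: edges_K3)
qed

lemma verts_wedge_K3: "verts wedge_K3 = insert (0, 0) (UNIV \<times> {1, 2})"
  by (auto simp: wedge_K3_def identify_def Let_def verts_omega_K3 image_iff)

lemma edges_wedge_K3:
  "edges wedge_K3 = (\<Union>n. {{(0, 0), (n, 1)}, {(0, 0), (n, 2)}, {(n, 1), (n, 2)}})"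
  (is "_ = ?R")
proof -
  define f where "f = (\<lambda>v :: nat \<times> nat. if v \<in> UNIV \<times> {0} then (0, 0) else v)"
  have W: "edges wedge_K3 = {{f u, f v} |u v. {u, v} \<in> edges omega_K3 \<and> f u \<noteq> f v}"
    unfolding wedge_K3_def identify_def Let_def f_def by simp
  have fs: "f (n, 0) = (0, 0)" "f (n, 1) = (n, 1)" "f (n, 2) = (n, 2)" for n
    by (auto simp: f_def)
  have "e \<in> ?R" if "e \<in> edges wedge_K3" for e
  proof -
    from that obtain u v where uv: "e = {f u, f v}" "{u, v} \<in> edges omega_K3" unfolding W by blast
    then have "e = f ` {u, v}" by simp
    moreover obtain n where "{u, v} \<in> {{(n, 0), (n, 1)}, {(n, 0), (n, 2)}, {(n, 1), (n, 2)}}"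
      using uv(2) unfolding edges_omega_K3 by blast
    moreover have "f ` {(n, 0), (n, 1)} = {(0, 0), (n, 1)}" "f ` {(n, 0), (n, 2)} = {(0, 0), (n, 2)}"
      "f ` {(n, 1), (n, 2)} = {(n, 1), (n, 2)}"
      by (simp_all only: image_insert image_empty fs)
    ultimately have "e \<in> {{(0, 0), (n, 1)}, {(0, 0), (n, 2)}, {(n, 1), (n, 2)}}"
      by (metis insert_iff empty_iff)
    then show ?thesis by blast
  qed
  moreover have "e \<in> edges wedge_K3" if "e \<in> ?R" for e
  proof -
    have image: "{f u, f v} \<in> edges wedge_K3" if "{u, v} \<in> edges omega_K3" "f u \<noteq> f v" for u v
      using that unfolding W by blast
    obtain n where n: "e \<in> {{(0, 0), (n, 1)}, {(0, 0), (n, 2)}, {(n, 1), (n, 2)}}"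
      using \<open>e \<in> ?R\<close> by blast
    have "{(n, 0), (n, 1)} \<in> edges omega_K3" "{(n, 0), (n, 2)} \<in> edges omega_K3"
      "{(n, 1), (n, 2)} \<in> edges omega_K3"
      unfolding edges_omega_K3 by blast+
    from this[THEN image] n show ?thesis by (auto simp: fs simp del: One_nat_def)
  qed
  ultimately show ?thesis by blast
qed

section \<open>Minors of graphs that are forests up to finitely many edges\<close>

text \<open>The matrix of the existential quantifier in \<^const>\<open>is_minor\<close>. Naming the branch sets lets
  several finite parts of \<open>H\<close> be examined in one and the same model.\<close>

definition minor_model :: "('b \<Rightarrow> 'a graph) \<Rightarrow> 'b graph \<Rightarrow> 'a graph \<Rightarrow> bool" where
  "minor_model B H G \<longleftrightarrow>
     (\<forall>v\<in>verts H. subgraph (B v) G \<and> connected_graph (B v) \<and> verts (B v) \<noteq> {}) \<and>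
     (\<forall>u\<in>verts H. \<forall>v\<in>verts H. u \<noteq> v \<longrightarrow> verts (B u) \<inter> verts (B v) = {}) \<and>
     (\<forall>u v. {u, v} \<in> edges H \<longrightarrow> (\<exists>x\<in>verts (B u). \<exists>y\<in>verts (B v). {x, y} \<in> edges G))"

lemma is_minor_iff: "is_minor H G \<longleftrightarrow> (\<exists>B. minor_model B H G)"
  by (simp add: is_minor_def minor_model_def)

text \<open>The excess of edges over vertices of a finite subgraph of \<open>H\<close> is not lost in a model of
  \<open>H\<close>: replace each of its vertices by a finite connected part of the branch set, which has at
  most one vertex more than edges, and each of its edges by an edge between branch sets.\<close>

lemma minor_model_excess:
  assumes model: "minor_model B H G" and H: "simple_graph H"
    and V0: "finite V0" "V0 \<subseteq> verts H" and E0: "E0 \<subseteq> edges H" "E0 \<subseteq> Pow V0"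
  obtains V E where "finite V" "V \<subseteq> (\<Union>v\<in>V0. verts (B v))" "E \<subseteq> edges G" "E \<subseteq> Pow V"
    "card V + card E0 \<le> card E + card V0"
    "V0 = {} \<or> V \<noteq> {}"
proof -
  have finE0: "finite E0" using V0 E0 by (auto intro: finite_subset)
  have Bv: "subgraph (B v) G" "connected_graph (B v)" "verts (B v) \<noteq> {}" "simple_graph (B v)"
    if "v \<in> V0" for v
    using model that V0(2) by (auto simp: minor_model_def subgraph_def)
  have disj: "v = v'" if "x \<in> verts (B v)" "x \<in> verts (B v')" "v \<in> V0" "v' \<in> V0" for x v v'
    using model that V0(2) unfolding minor_model_def by blast
  have "\<exists>f. \<exists>u v x y. e = {u, v} \<and> u \<noteq> v \<and> x \<in> verts (B u) \<and> y \<in> verts (B v) \<and> f = {x, y} \<and>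
      f \<in> edges G" if e: "e \<in> E0" for e
  proof -
    have "card e = 2" using H E0 e by (auto simp: simple_graph_def)
    then obtain u v where "e = {u, v}" "u \<noteq> v" by (auto simp: card_2_iff)
    moreover have "\<exists>x\<in>verts (B u). \<exists>y\<in>verts (B v). {x, y} \<in> edges G"
      using model E0 e \<open>e = {u, v}\<close> by (auto simp: minor_model_def)
    ultimately show ?thesis by blast
  qed
  then obtain g where g: "\<And>e. e \<in> E0 \<Longrightarrow> \<exists>u v x y. e = {u, v} \<and> u \<noteq> v \<and> x \<in> verts (B u) \<and>
      y \<in> verts (B v) \<and> g e = {x, y} \<and> g e \<in> edges G"
    by metis
  \<comment> \<open>The ends of \<open>g e\<close> determine \<open>e\<close>, because the branch sets are disjoint.\<close>
  have recover: "e = {w \<in> V0. verts (B w) \<inter> g e \<noteq> {}}" if e: "e \<in> E0" for e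
  proof -
    obtain u v x y where *: "e = {u, v}" "x \<in> verts (B u)" "y \<in> verts (B v)" "g e = {x, y}"
      using g[OF e] by blast
    have "u \<in> V0" "v \<in> V0" using E0(2) e *(1) by auto
    with * disj show ?thesis by auto
  qed
  have inj: "inj_on g E0" 
  proof (rule inj_onI)
    fix e e' assume e: "e \<in> E0" "e' \<in> E0" "g e = g e'"
    have "e = {w \<in> V0. verts (B w) \<inter> g e' \<noteq> {}}" using recover[OF e(1)] unfolding e(3) .
    also have "\<dots> = e'" by (rule recover[OF e(2), symmetric])
    finally show "e = e'" .
  qed
  define R where "R = (\<lambda>v. \<Union>(g ` E0) \<inter> verts (B v))"
  have finR: "finite (R v)" for v
  proof -
    have "finite (g e)" if "e \<in> E0" for e using g[OF that] by auto
    then show ?thesis using finE0 by (auto simp: R_def)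
  qed
  have "\<exists>V E. finite V \<and> V \<noteq> {} \<and> R v \<subseteq> V \<and> V \<subseteq> verts (B v) \<and> E \<subseteq> edges (B v) \<and> E \<subseteq> Pow V \<and>
      card V \<le> card E + 1" if v: "v \<in> V0" for v
  proof -
    obtain r where "r \<in> verts (B v)" using Bv(3)[OF v] by blast
    then show ?thesis
      using finite_connected_subgraph[OF Bv(2)[OF v] finR _ _ Bv(4)[OF v]]
      by (metis R_def inf_le2 insert_subset empty_iff)
  qed
  then obtain Vs where "\<forall>v\<in>V0. \<exists>E. finite (Vs v) \<and> Vs v \<noteq> {} \<and> R v \<subseteq> Vs v \<and>
      Vs v \<subseteq> verts (B v) \<and> E \<subseteq> edges (B v) \<and> E \<subseteq> Pow (Vs v) \<and> card (Vs v) \<le> card E + 1"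
    by metis
  then obtain Es where "\<forall>v\<in>V0. finite (Vs v) \<and> Vs v \<noteq> {} \<and> R v \<subseteq> Vs v \<and>
      Vs v \<subseteq> verts (B v) \<and> Es v \<subseteq> edges (B v) \<and> Es v \<subseteq> Pow (Vs v) \<and>
      card (Vs v) \<le> card (Es v) + 1"
    by metis
  then have T: "finite (Vs v)" "Vs v \<noteq> {}" "R v \<subseteq> Vs v" "Vs v \<subseteq> verts (B v)"
    "Es v \<subseteq> edges (B v)" "Es v \<subseteq> Pow (Vs v)" "card (Vs v) \<le> card (Es v) + 1"
    if "v \<in> V0" for v
    using that by blast+
  define V where "V = (\<Union>v\<in>V0. Vs v)"
  define E1 where "E1 = (\<Union>v\<in>V0. Es v)"
  have finEs: "finite (Es v)" if "v \<in> V0" for v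
    using T(1,6)[OF that] by (auto intro: finite_subset)
  have nonempty_edge: "e \<noteq> {}" if "e \<in> Es v" "v \<in> V0" for e v
    using Bv(4)[OF that(2)] T(5)[OF that(2)] that(1) by (force simp: simple_graph_def)
  have "card E1 = (\<Sum>v\<in>V0. card (Es v))"
    unfolding E1_def
  proof (rule card_UN_disjoint)
    show "\<forall>i\<in>V0. \<forall>j\<in>V0. i \<noteq> j \<longrightarrow> Es i \<inter> Es j = {}"
    proof (intro ballI impI equals0I)
      fix i j e assume ij: "i \<in> V0" "j \<in> V0" "i \<noteq> j" and e: "e \<in> Es i \<inter> Es j"
      then obtain x where "x \<in> e" using nonempty_edge by blast
      then have "x \<in> verts (B i)" "x \<in> verts (B j)" using e T(4,6) ij by blast+
      then show False using disj ij by blast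
    qed
  qed (use V0 finEs in auto)
  moreover have "card V \<le> (\<Sum>v\<in>V0. card (Vs v))"
    unfolding V_def using V0(1) by (rule card_UN_le)
  moreover have "(\<Sum>v\<in>V0. card (Vs v)) \<le> (\<Sum>v\<in>V0. card (Es v) + 1)"
    using T(7) by (rule sum_mono)
  ultimately have "card V \<le> card E1 + card V0" by (simp add: sum_Suc)
  moreover have "card (E1 \<union> g ` E0) = card E1 + card E0"
  proof -
    have "e \<notin> g ` E0" if "e \<in> E1" for e
    proof
      assume "e \<in> g ` E0"
      then obtain e' where e': "e' \<in> E0" "e = g e'" by blast
      obtain w where w: "w \<in> V0" "e \<in> Es w" using \<open>e \<in> E1\<close> by (auto simp: E1_def)
      then have "e \<subseteq> verts (B w)" using T(4,6) by blast
      obtain u v x y where *: "e' = {u, v}" "u \<noteq> v" "x \<in> verts (B u)" "y \<in> verts (B v)" "e = {x, y}"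
        using g[OF e'(1)] e'(2) by blast
      have "u \<in> V0" "v \<in> V0" using E0(2) e' *(1) by auto
      then have "u = w" "v = w" using * \<open>e \<subseteq> verts (B w)\<close> w disj by auto
      with * show False by simp
    qed
    then have "E1 \<inter> g ` E0 = {}" by blast
    moreover have "finite E1" using finEs V0 by (simp add: E1_def)
    ultimately show ?thesis using finE0 inj by (simp add: card_Un_disjoint card_image)
  qed
  ultimately have "card V + card E0 \<le> card (E1 \<union> g ` E0) + card V0" by linarith
  moreover have "finite V" using V0 T(1) by (simp add: V_def)
  moreover have "V \<subseteq> (\<Union>v\<in>V0. verts (B v))" using T(4) by (auto simp: V_def)
  moreover have "E1 \<union> g ` E0 \<subseteq> edges G"
    using T(5) Bv(1) g by (fastforce simp: E1_def subgraph_def)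
  moreover have "E1 \<union> g ` E0 \<subseteq> Pow V"
  proof -
    have "g e \<subseteq> V" if e: "e \<in> E0" for e
    proof
      fix x assume x: "x \<in> g e"
      have "\<exists>u\<in>e. x \<in> verts (B u)" using g[OF e] x by auto
      then obtain u where "u \<in> e" "x \<in> verts (B u)" by blast
      moreover from this have "u \<in> V0" using E0 e by auto
      ultimately show "x \<in> V" using T(3)[of u] x e by (auto simp: R_def V_def)
    qed
    then show ?thesis using T(6) by (fastforce simp: E1_def V_def)
  qed
  moreover have "V0 = {} \<or> V \<noteq> {}" using T(2) by (auto simp: V_def)
  ultimately show ?thesis by (intro that[of V "E1 \<union> g ` E0"])
qed

lemma forest_remainder_card:
  assumes G: "simple_graph G" and F: "finite F" "remove_edges G F \<in> forests"
    and V: "finite V" "V \<noteq> {}" and E: "E \<subseteq> edges G" "E \<subseteq> Pow V"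
  shows "card (E - F) < card V"
proof (rule ccontr)
  assume "\<not> card (E - F) < card V"
  moreover have "simple_graph (Graph V (E - F))" using G E by (auto simp: simple_graph_def)
  ultimately obtain c where "is_cycle (Graph V (E - F)) c"
    using many_edges_has_cycle[OF V] by (meson not_less)
  then have "is_cycle (remove_edges G F) c"
    by (rule is_cycle_mono) (use E in \<open>auto simp: remove_edges_def\<close>)
  then show False using F(2) by (auto simp: forests_def)
qed

text \<open>Removing \<open>F\<close> lowers the number of edges of a finite subgraph of \<open>G\<close> by at most \<open>card F\<close> and
  must bring it below the number of vertices.\<close>

lemma forests_E_excess_bounded:
  assumes G: "simple_graph G" and F: "finite F" "remove_edges G F \<in> forests"
    and minor: "is_minor H G" and H: "simple_graph H"
    and V0: "finite V0" "V0 \<noteq> {}" "V0 \<subseteq> verts H" and E0: "E0 \<subseteq> edges H" "E0 \<subseteq> Pow V0"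
  shows "card E0 < card V0 + card F"
proof -
  obtain B where "minor_model B H G" using minor by (auto simp: is_minor_iff)
  from minor_model_excess[OF this H V0(1,3) E0] V0(2)
  obtain V E where VE: "finite V" "V \<noteq> {}" "E \<subseteq> edges G" "E \<subseteq> Pow V"
    "card V + card E0 \<le> card E + card V0" by metis
  have "card (E - F) < card V" by (rule forest_remainder_card[OF G F VE(1-4)])
  moreover have "card E \<le> card (E - F) + card F"
    using F(1) by (metis diff_card_le_card_Diff le_diff_conv)
  ultimately show ?thesis using VE(5) by linarith
qed

lemma wedge_K3_not_minor:
  assumes G: "simple_graph G" and F: "finite F" "remove_edges G F \<in> forests"
  shows "\<not> is_minor wedge_K3 G"
proof
  assume minor: "is_minor wedge_K3 G"
  \<comment> \<open>The first \<open>n\<close> triangles have \<open>2 * n + 1\<close> vertices and \<open>3 * n\<close> edges.\<close>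
  define n where "n = Suc (card F)"
  let ?V = "insert (0, 0) ({..<n} \<times> {1, 2}) :: (nat \<times> nat) set"
  define h :: "nat \<times> nat \<Rightarrow> (nat \<times> nat) set" where "h = (\<lambda>(i, k). if k = 0 then {(0, 0), (i, 1)}
    else if k = 1 then {(0, 0), (i, 2)} else {(i, 1), (i, 2)})"
  let ?E = "h ` ({..<n} \<times> {0, 1, 2 :: nat})"
  have "card ?E < card ?V + card F"
  proof (rule forests_E_excess_bounded[OF G F minor])
    show "simple_graph wedge_K3"
      using wedge_K3_in_countable_graphs by (simp add: countable_graphs_def)
    show "?V \<subseteq> verts wedge_K3" by (auto simp: verts_wedge_K3)
    have "{(0, 0), (i, 1)} \<in> edges wedge_K3" "{(0, 0), (i, 2)} \<in> edges wedge_K3"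
      "{(i, 1), (i, 2)} \<in> edges wedge_K3" for i
      unfolding edges_wedge_K3 by blast+
    then show "?E \<subseteq> edges wedge_K3" by (auto simp: h_def simp del: One_nat_def)
    show "?E \<subseteq> Pow ?V" by (auto simp: h_def)
  qed auto
  moreover have "inj_on h ({..<n} \<times> {0, 1, 2})"
    by (auto simp: inj_on_def h_def doubleton_eq_iff)
  then have "card ?E = 3 * n" by (simp add: card_image card_cartesian_product)
  moreover have "card ?V \<le> Suc (2 * n)" by (simp add: card_insert_if card_cartesian_product)
  ultimately show False using n_def by linarith
qed

lemma K2_omega_not_minor:
  assumes G: "simple_graph G" and F: "finite F" "remove_edges G F \<in> forests"
  shows "\<not> is_minor K2_omega G"
proof
  assume minor: "is_minor K2_omega G"
  \<comment> \<open>The subgraph \<open>K\<^sub>2\<^sub>,\<^sub>n\<close> has \<open>n + 2\<close> vertices and \<open>2 * n\<close> edges.\<close>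
  define n where "n = card F + 2"
  let ?V = "{0} \<times> {0, 1} \<union> {1} \<times> {..<n} :: (nat \<times> nat) set"
  define h :: "nat \<times> nat \<Rightarrow> (nat \<times> nat) set" where "h = (\<lambda>(i, k). {(0, k), (1, i)})"
  let ?E = "h ` ({..<n} \<times> {0, 1})"
  have "card ?E < card ?V + card F"
  proof (rule forests_E_excess_bounded[OF G F minor])
    show "simple_graph K2_omega"
      using K2_omega_in_countable_graphs by (simp add: countable_graphs_def)
    show "?V \<subseteq> verts K2_omega" by (auto simp: K2_omega_def complete_bipartite_def)
    show "?E \<subseteq> edges K2_omega" by (auto simp: h_def K2_omega_def complete_bipartite_def)
    show "?E \<subseteq> Pow ?V" by (auto simp: h_def)
  qed auto
  moreover have "inj_on h ({..<n} \<times> {0, 1})"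
    by (auto simp: inj_on_def h_def doubleton_eq_iff)
  then have "card ?E = 2 * n" by (simp add: card_image card_cartesian_product)
  moreover have "card ?V \<le> 2 + n"
    by (rule order_trans[OF card_Un_le]) (simp add: card_cartesian_product)
  ultimately show False using n_def by linarith
qed

text \<open>Disjoint triangles have no excess of edges over vertices, so counting all at once gives
  nothing here. Instead, each triangle of the model yields its own subgraph with at least as many
  edges as vertices; these are disjoint, so one of them avoids the finitely many removed edges.\<close>

lemma omega_K3_not_minor:
  assumes G: "simple_graph G" and F: "finite F" "remove_edges G F \<in> forests"
  shows "\<not> is_minor omega_K3 G"
proof
  assume "is_minor omega_K3 G"
  then obtain B where B: "minor_model B omega_K3 G" by (auto simp: is_minor_iff)
  let ?V0 = "\<lambda>n. {n} \<times> {0, 1, 2} :: (nat \<times> nat) set"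
  let ?E0 = "\<lambda>n. {{(n, 0), (n, 1)}, {(n, 0), (n, 2)}, {(n, 1), (n, 2)}} :: (nat \<times> nat) set set"
  have simple: "simple_graph omega_K3"
    using omega_K3_in_countable_graphs by (simp add: countable_graphs_def)
  have "\<exists>e. e \<in> F \<and> e \<in> edges G \<and> e \<subseteq> (\<Union>v\<in>?V0 n. verts (B v))" for n
  proof -
    have card: "card (?E0 n) = 3" "card (?V0 n) = 3"
      by (auto simp: doubleton_eq_iff card_cartesian_product card_insert_if)
    have fin: "finite (?V0 n)" by simp
    have sub: "?V0 n \<subseteq> verts omega_K3" "?E0 n \<subseteq> edges omega_K3" "?E0 n \<subseteq> Pow (?V0 n)"
      by (auto simp: verts_omega_K3 edges_omega_K3)
    obtain V E where VE: "finite V" "V \<subseteq> (\<Union>v\<in>?V0 n. verts (B v))" "E \<subseteq> edges G" "E \<subseteq> Pow V"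
      "card V + card (?E0 n) \<le> card E + card (?V0 n)" "?V0 n = {} \<or> V \<noteq> {}"
      by (rule minor_model_excess[OF B simple fin sub])
    have "V \<noteq> {}" using VE(6) by simp
    then have "card (E - F) < card V" using forest_remainder_card[OF G F VE(1) _ VE(3,4)] by blast
    then have "E - F \<noteq> E" using VE(5) card by auto
    then show ?thesis using VE(2-4) by blast
  qed
  then obtain e where e: "\<And>n. e n \<in> F" "\<And>n. e n \<in> edges G"
    "\<And>n. e n \<subseteq> (\<Union>v\<in>?V0 n. verts (B v))" by metis
  have "inj e"
  proof (rule injI)
    fix m n assume eq: "e m = e n"
    have "e n \<noteq> {}" using G e(2)[of n] by (force simp: simple_graph_def)
    then obtain x where "x \<in> e n" by blast
    obtain v where v: "v \<in> ?V0 m" "x \<in> verts (B v)" using e(3)[of m] eq \<open>x \<in> e n\<close> by blast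
    obtain w where w: "w \<in> ?V0 n" "x \<in> verts (B w)" using e(3)[of n] \<open>x \<in> e n\<close> by blast
    have "v \<in> verts omega_K3" "w \<in> verts omega_K3" using v w unfolding verts_omega_K3 by blast+
    then have "v = w" using B v(2) w(2) unfolding minor_model_def by blast
    then show "m = n" using v(1) w(1) by auto
  qed
  moreover have "range e \<subseteq> F" using e(1) by blast
  ultimately show False using F(1) by (meson finite_imageD finite_subset infinite_UNIV_nat)
qed

section \<open>Finding the excluded minors\<close>

lemma is_minorI:
  assumes G: "simple_graph G"
    and S: "\<And>v. v \<in> verts H \<Longrightarrow> S v \<subseteq> verts G \<and> S v \<noteq> {} \<and> conn G (S v)"
    and disj: "\<And>u v. u \<in> verts H \<Longrightarrow> v \<in> verts H \<Longrightarrow> u \<noteq> v \<Longrightarrow> S u \<inter> S v = {}"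
    and E: "\<And>e. e \<in> edges H \<Longrightarrow> \<exists>u v. e = {u, v} \<and> (\<exists>x\<in>S u. \<exists>y\<in>S v. adj G x y)"
  shows "is_minor H G"
proof -
  have "\<exists>x\<in>S u. \<exists>y\<in>S v. {x, y} \<in> edges G" if uv: "{u, v} \<in> edges H" for u v
  proof -
    obtain u' v' where e: "{u, v} = {u', v'}" "\<exists>x\<in>S u'. \<exists>y\<in>S v'. adj G x y" using E[OF uv] by blast
    from e(1) consider "u = u'" "v = v'" | "u = v'" "v = u'" by (auto simp: doubleton_eq_iff)
    then show ?thesis
      by cases (use e(2) in \<open>metis adj_def adj_sym\<close>)+
  qed
  moreover have "subgraph (induced G (S v)) G" if "v \<in> verts H" for v
    using G S[OF that] by (auto simp: subgraph_def induced_def simple_graph_def)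
  ultimately have "minor_model (\<lambda>v. induced G (S v)) H G"
    using S disj by (auto simp: minor_model_def conn_def)
  then show ?thesis by (auto simp: is_minor_iff)
qed

text \<open>What remains of a cycle through \<open>x\<close> when \<open>x\<close> is deleted, with the path relaxed to a connected
  set. This form suits both triangle minors: for \<open>\<omega>\<cdot>K\<^sub>3\<close> the vertex \<open>x\<close> varies, for
  \<open>\<Or>K\<^sub>3\<close> it is fixed and only the sets are disjoint.\<close>

definition attached_twice :: "'a graph \<Rightarrow> 'a \<Rightarrow> 'a set \<Rightarrow> bool" where
  "attached_twice G x T \<longleftrightarrow> finite T \<and> x \<notin> T \<and> T \<subseteq> verts G \<and> conn G T \<and>
     (\<exists>a\<in>T. \<exists>b\<in>T. a \<noteq> b \<and> adj G x a \<and> adj G x b)"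

text \<open>One of two neighbours \<open>a\<close>, \<open>b\<close> of \<open>x\<close> in \<open>T\<close> serves as \<open>A\<close>, and the component of
  the other one in \<open>T - {a}\<close> as \<open>B\<close>: a walk in \<open>T\<close> from \<open>b\<close> to \<open>a\<close> first meets \<open>a\<close> from
  that component. Together with \<open>x\<close> this gives a triangle.\<close>

lemma attached_twice_split:
  assumes "attached_twice G x T"
  shows "\<exists>A B. A \<subseteq> T \<and> B \<subseteq> T \<and> A \<inter> B = {} \<and> conn G A \<and> conn G B \<and> A \<noteq> {} \<and> B \<noteq> {} \<and>
    (\<exists>a\<in>A. adj G x a) \<and> (\<exists>b\<in>B. adj G x b) \<and> (\<exists>a\<in>A. \<exists>b\<in>B. adj G a b)"
proof -
  obtain a b where ab: "a \<in> T" "b \<in> T" "a \<noteq> b" "adj G x a" "adj G x b" and T: "conn G T"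
    using assms by (auto simp: attached_twice_def)
  let ?B = "component G (T - {a}) b"
  have sub: "?B \<subseteq> T - {a}" using ab by (intro component_subset) auto
  have "y \<in> ?B \<or> (\<exists>z\<in>?B. adj G z a)" if "(adj (induced G T))\<^sup>*\<^sup>* b y" for y
    using that
  proof (induction rule: rtranclp_induct)
    case base
    then show ?case by (simp add: component_self)
  next
    case (step y z)
    then have yz: "adj G y z" "y \<in> T" "z \<in> T" by (auto simp: adj_induced)
    show ?case
    proof (cases "y \<in> ?B \<and> z \<noteq> a")
      case True
      have "z \<in> ?B"
        by (rule component_closed[of y]) (use True yz sub in blast)+
      then show ?thesis by blast
    next
      case False
      then show ?thesis using step.IH yz by blast
    qed
  qed
  moreover have "(adj (induced G T))\<^sup>*\<^sup>* b a"
    using T ab by (auto simp: conn_def connected_graph_def)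
  ultimately have "a \<in> ?B \<or> (\<exists>z\<in>?B. adj G z a)" by blast
  then obtain z where "z \<in> ?B" "adj G z a" using sub by blast
  then have "\<exists>z\<in>?B. adj G a z" using adj_sym[of G z a] by blast
  moreover have "b \<in> ?B" by (rule component_self)
  moreover have "{a} \<subseteq> T" "?B \<subseteq> T" "{a} \<inter> ?B = {}" using sub ab(1) by blast+
  moreover have "conn G {a}" by (rule conn_singleton)
  moreover have "conn G ?B" by (rule conn_component)
  ultimately show ?thesis using ab(4,5) by blast
qed

text \<open>The disjoint sets are picked one after the other, each avoiding the union of its
  predecessors.\<close>

lemma infinite_disjoint_sequence:
  assumes fin: "\<And>S. P S \<Longrightarrow> finite S"
    and avoid: "\<And>U. finite U \<Longrightarrow> \<exists>S. P S \<and> S \<inter> U = {}"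
  obtains f :: "nat \<Rightarrow> 'a set" where "\<And>n. P (f n)" "\<And>m n. m \<noteq> n \<Longrightarrow> f m \<inter> f n = {}"
proof -
  let ?ok = "\<lambda>(n :: nat) x. P (fst x) \<and> finite (snd x) \<and> fst x \<subseteq> snd x"
  let ?next = "\<lambda>(n :: nat) x y. snd x \<subseteq> snd y \<and> fst y \<inter> snd x = {}"
  have "\<exists>f. \<forall>n. ?ok n (f n) \<and> ?next n (f n) (f (Suc n))"
  proof (rule dependent_nat_choice)
    obtain S where "P S" using avoid[of "{}"] by blast
    then have "?ok 0 (S, S)" using fin by simp
    then show "\<exists>x. ?ok 0 x" by (rule exI)
  next
    fix x :: "'a set \<times> 'a set" and n assume x: "?ok n x"
    then have "finite (snd x)" by auto
    then obtain S where S: "P S" "S \<inter> snd x = {}" using avoid by blast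
    have "?ok (Suc n) (S, S \<union> snd x) \<and> ?next n x (S, S \<union> snd x)"
      using x S fin by auto
    then show "\<exists>y. ?ok (Suc n) y \<and> ?next n x y" by (rule exI)
  qed
  then obtain f where f: "\<And>n. ?ok n (f n)" "\<And>n. ?next n (f n) (f (Suc n))" by blast
  have mono: "snd (f m) \<subseteq> snd (f n)" if "m \<le> n" for m n
    using that by (rule lift_Suc_mono_le[rotated]) (use f(2) in blast)
  have less: "fst (f m) \<inter> fst (f n) = {}" if "m < n" for m n
  proof -
    obtain k where k: "n = Suc k" "m \<le> k" using \<open>m < n\<close> by (cases n) auto
    have "fst (f m) \<subseteq> snd (f k)" using f(1)[of m] mono[OF k(2)] by blast
    then show ?thesis using f(2)[of k] k(1) by blast
  qed
  have "fst (f m) \<inter> fst (f n) = {}" if "m \<noteq> n" for m n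
    using less[of m n] less[of n m] that by (metis Int_commute linorder_neqE_nat)
  moreover have "P (fst (f n))" for n using f(1)[of n] by blast
  ultimately show ?thesis by (intro that[of "\<lambda>n. fst (f n)"])
qed

lemma omega_K3_minor:
  fixes G :: "'a graph"
  assumes G: "simple_graph G"
    and avoid: "\<And>U. finite U \<Longrightarrow> \<exists>x T. attached_twice G x T \<and> insert x T \<inter> U = {}"
  shows "is_minor omega_K3 G"
proof -
  obtain f :: "nat \<Rightarrow> 'a set" where f: "\<And>n. \<exists>x T. attached_twice G x T \<and> f n = insert x T"
    "\<And>m n. m \<noteq> n \<Longrightarrow> f m \<inter> f n = {}"
  proof (rule infinite_disjoint_sequence[of "\<lambda>S. \<exists>x T. attached_twice G x T \<and> S = insert x T"])
    show "finite S" if "\<exists>x T. attached_twice G x T \<and> S = insert x T" for S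
      using that by (auto simp: attached_twice_def)
    show "\<exists>S. (\<exists>x T. attached_twice G x T \<and> S = insert x T) \<and> S \<inter> U = {}" if "finite U" for U
      using avoid[OF that] by blast
  qed blast
  from f(1) obtain x T where T: "\<And>n. attached_twice G (x n) (T n)" "\<And>n. f n = insert (x n) (T n)"
    by metis
  have "\<exists>A B. A \<subseteq> T n \<and> B \<subseteq> T n \<and> A \<inter> B = {} \<and> conn G A \<and> conn G B \<and> A \<noteq> {} \<and> B \<noteq> {} \<and>
    (\<exists>a\<in>A. adj G (x n) a) \<and> (\<exists>b\<in>B. adj G (x n) b) \<and> (\<exists>a\<in>A. \<exists>b\<in>B. adj G a b)" for n
    by (rule attached_twice_split[OF T(1)])
  then obtain A B where AB: "\<And>n. A n \<subseteq> T n" "\<And>n. B n \<subseteq> T n" "\<And>n. A n \<inter> B n = {}"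
    "\<And>n. conn G (A n)" "\<And>n. conn G (B n)" "\<And>n. A n \<noteq> {}" "\<And>n. B n \<noteq> {}"
    "\<And>n. \<exists>a\<in>A n. adj G (x n) a" "\<And>n. \<exists>b\<in>B n. adj G (x n) b"
    "\<And>n. \<exists>a\<in>A n. \<exists>b\<in>B n. adj G a b" by metis
  have x: "x n \<notin> T n" "T n \<subseteq> verts G" "x n \<in> verts G" for n
    using T(1)[of n] AB(8)[of n] adj_simple[OF G] by (auto simp: attached_twice_def)
  have AB_verts: "A n \<subseteq> verts G" "B n \<subseteq> verts G" for n using x(2) AB(1,2) by blast+
  define S where "S = (\<lambda>(n, k :: nat). if k = 0 then {x n} else if k = 1 then A n else B n)"
  have Sf: "S (n, k) \<subseteq> f n" for n k using AB(1,2) T(2) by (auto simp: S_def)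
  show ?thesis
  proof (rule is_minorI[OF G, of _ S])
    fix v assume "v \<in> verts omega_K3"
    show "S v \<subseteq> verts G \<and> S v \<noteq> {} \<and> conn G (S v)"
      using x(3) AB(4-7) AB_verts by (cases v) (auto simp: S_def conn_singleton)
  next
    fix u v assume *: "u \<in> verts omega_K3" "v \<in> verts omega_K3" "u \<noteq> v"
    obtain m k where u: "u = (m, k)" by (cases u)
    obtain n l where v: "v = (n, l)" by (cases v)
    have uv: "u = (m, k)" "v = (n, l)" "k \<in> {0, 1, 2}" "l \<in> {0, 1, 2}" "(m, k) \<noteq> (n, l)"
      using * u v by (auto simp: verts_omega_K3)
    show "S u \<inter> S v = {}"
    proof (cases "m = n")
      case True
      have "x n \<notin> A n" "x n \<notin> B n" using x AB by blast+
      with uv True AB(3)[of n] show ?thesis by (auto simp: S_def)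
    next
      case False
      then show ?thesis using f(2)[OF False] Sf uv by blast
    qed
  next
    fix e assume "e \<in> edges omega_K3"
    then obtain n where "e = {(n, 0), (n, 1)} \<or> e = {(n, 0), (n, 2)} \<or> e = {(n, 1), (n, 2)}"
      unfolding edges_omega_K3 by blast
    moreover have "S (n, 0) = {x n}" "S (n, 1) = A n" "S (n, 2) = B n" by (auto simp: S_def)
    ultimately show "\<exists>u v. e = {u, v} \<and> (\<exists>x\<in>S u. \<exists>y\<in>S v. adj G x y)"
      using AB(8-10)[of n] by (metis singletonI)
  qed
qed

lemma wedge_K3_minor:
  fixes G :: "'a graph"
  assumes G: "simple_graph G"
    and avoid: "\<And>U. finite U \<Longrightarrow> \<exists>T. attached_twice G x T \<and> T \<inter> U = {}"
  shows "is_minor wedge_K3 G"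
proof -
  obtain T :: "nat \<Rightarrow> 'a set" where T: "\<And>n. attached_twice G x (T n)" "\<And>m n. m \<noteq> n \<Longrightarrow> T m \<inter> T n = {}"
  proof (rule infinite_disjoint_sequence[of "attached_twice G x"])
    show "finite S" if "attached_twice G x S" for S
      using that by (simp add: attached_twice_def)
  qed (rule avoid | blast)+
  have "\<exists>A B. A \<subseteq> T n \<and> B \<subseteq> T n \<and> A \<inter> B = {} \<and> conn G A \<and> conn G B \<and> A \<noteq> {} \<and> B \<noteq> {} \<and>
    (\<exists>a\<in>A. adj G x a) \<and> (\<exists>b\<in>B. adj G x b) \<and> (\<exists>a\<in>A. \<exists>b\<in>B. adj G a b)" for n
    by (rule attached_twice_split[OF T(1)])
  then obtain A B where AB: "\<And>n. A n \<subseteq> T n" "\<And>n. B n \<subseteq> T n" "\<And>n. A n \<inter> B n = {}"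
    "\<And>n. conn G (A n)" "\<And>n. conn G (B n)" "\<And>n. A n \<noteq> {}" "\<And>n. B n \<noteq> {}"
    "\<And>n. \<exists>a\<in>A n. adj G x a" "\<And>n. \<exists>b\<in>B n. adj G x b"
    "\<And>n. \<exists>a\<in>A n. \<exists>b\<in>B n. adj G a b" by metis
  have x: "x \<notin> T n" "T n \<subseteq> verts G" "x \<in> verts G" for n
    using T(1)[of n] AB(8)[of n] adj_simple[OF G] by (auto simp: attached_twice_def)
  have AB_verts: "A n \<subseteq> verts G" "B n \<subseteq> verts G" for n using x(2) AB(1,2) by blast+
  define S where "S = (\<lambda>(n, k :: nat). if k = 0 then {x} else if k = 1 then A n else B n)"
  have ST: "S (n, k) \<subseteq> T n" if "k \<noteq> 0" for n k using AB(1,2) that by (auto simp: S_def)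
  show ?thesis
  proof (rule is_minorI[OF G, of _ S])
    fix v assume "v \<in> verts wedge_K3"
    show "S v \<subseteq> verts G \<and> S v \<noteq> {} \<and> conn G (S v)"
      using x(3) AB(4-7) AB_verts by (cases v) (auto simp: S_def conn_singleton)
  next
    fix u v assume *: "u \<in> verts wedge_K3" "v \<in> verts wedge_K3" "u \<noteq> v"
    obtain m k where u: "u = (m, k)" by (cases u)
    obtain n l where v: "v = (n, l)" by (cases v)
    have uv: "u = (m, k)" "v = (n, l)" "k \<in> {0, 1, 2}" "l \<in> {0, 1, 2}" "(m, k) \<noteq> (n, l)"
      "k = 0 \<Longrightarrow> m = 0" "l = 0 \<Longrightarrow> n = 0"
      using * u v by (auto simp: verts_wedge_K3)
    consider "k = 0" "l \<noteq> 0" | "k \<noteq> 0" "l = 0" | "k \<noteq> 0" "l \<noteq> 0" "m \<noteq> n"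
      | "k \<noteq> 0" "l \<noteq> 0" "m = n" "k \<noteq> l"
      using uv by (cases "k = 0"; cases "l = 0") auto
    then show "S u \<inter> S v = {}"
    proof cases
      case 1
      then show ?thesis using uv ST[of l n] x(1)[of n] by (auto simp: S_def)
    next
      case 2
      then show ?thesis using uv ST[of k m] x(1)[of m] by (auto simp: S_def)
    next
      case 3
      then show ?thesis using uv ST[of k m] ST[of l n] T(2)[of m n] by blast
    next
      case 4
      then show ?thesis using uv AB(3)[of n] by (auto simp: S_def)
    qed
  next
    fix e assume "e \<in> edges wedge_K3"
    then obtain n where "e = {(0, 0), (n, 1)} \<or> e = {(0, 0), (n, 2)} \<or> e = {(n, 1), (n, 2)}"
      unfolding edges_wedge_K3 by blast
    moreover have "S (0, 0) = {x}" "S (n, 1) = A n" "S (n, 2) = B n" by (auto simp: S_def)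
    ultimately show "\<exists>u v. e = {u, v} \<and> (\<exists>x\<in>S u. \<exists>y\<in>S v. adj G x y)"
      using AB(8-10)[of n] by (metis singletonI)
  qed
qed

lemma K2_omega_minor:
  fixes G :: "'a graph"
  assumes G: "simple_graph G" and inf: "infinite \<D>"
    and disj: "\<And>C D. C \<in> \<D> \<Longrightarrow> D \<in> \<D> \<Longrightarrow> C \<noteq> D \<Longrightarrow> C \<inter> D = {}"
    and D: "\<And>D. D \<in> \<D> \<Longrightarrow> D \<subseteq> verts G \<and> conn G D \<and> u \<notin> D \<and> v \<notin> D"
    and nb: "\<And>D. D \<in> \<D> \<Longrightarrow> (\<exists>a\<in>D. adj G u a) \<and> (\<exists>b\<in>D. adj G v b)"
    and "u \<noteq> v"
  shows "is_minor K2_omega G"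
proof -
  obtain f :: "nat \<Rightarrow> 'a set" where f: "inj f" "range f \<subseteq> \<D>"
    using infinite_countable_subset[OF inf] by blast
  have fD: "f n \<in> \<D>" for n using f(2) by blast
  have ff: "f m \<inter> f n = {}" if "m \<noteq> n" for m n
    using disj[OF fD fD] that f(1) by (metis injD)
  have uv: "u \<in> verts G" "v \<in> verts G" using nb[OF fD] adj_simple[OF G] by blast+
  define S where "S = (\<lambda>(i :: nat, n :: nat). if i = 1 then f n else if n = 0 then {u} else {v})"
  show ?thesis
  proof (rule is_minorI[OF G, of _ S])
    fix w assume "w \<in> verts K2_omega"
    show "S w \<subseteq> verts G \<and> S w \<noteq> {} \<and> conn G (S w)"
      using uv D[OF fD] nb[OF fD] by (cases w) (auto simp: S_def conn_singleton)
  next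
    fix w z assume "w \<in> verts K2_omega" "z \<in> verts K2_omega" "w \<noteq> z"
    then show "S w \<inter> S z = {}"
      using D[OF fD] \<open>u \<noteq> v\<close>
      by (auto simp: S_def K2_omega_def complete_bipartite_def) (use ff in blast)
  next
    fix e assume "e \<in> edges K2_omega"
    then obtain n where "e = {(0, 0), (1, n)} \<or> e = {(0, 1), (1, n)}"
      by (auto simp: K2_omega_def complete_bipartite_def)
    moreover have "S (0, 0) = {u}" "S (0, 1) = {v}" "S (1, n) = f n" by (auto simp: S_def)
    ultimately show "\<exists>w z. e = {w, z} \<and> (\<exists>x\<in>S w. \<exists>y\<in>S z. adj G x y)"
      using nb[OF fD[of n]] by (metis singletonI)
  qed
qed

section \<open>Graphs without the excluded minors\<close>

lemma cycle_attached_twice: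
  assumes G: "simple_graph G" and c: "is_cycle G c"
  obtains x T where "attached_twice G x T" "insert x T = set c"
proof -
  obtain x p where xp: "c = x # p" using c by (cases c) (auto simp: is_cycle_def)
  have len: "2 \<le> length p" and dist: "distinct p" "x \<notin> set p"
    and e: "\<And>i. i < length c \<Longrightarrow> adj G (c ! i) (c ! (Suc i mod length c))"
    using c xp by (auto simp: is_cycle_def)
  have "adj G (p ! i) (p ! Suc i)" if "Suc i < length p" for i
    using e[of "Suc i"] that by (simp add: xp)
  moreover have "p \<noteq> []" using len by auto
  ultimately have "conn G (set p)" by (intro conn_path)
  moreover have "adj G x (p ! 0)" using e[of 0] \<open>p \<noteq> []\<close> by (simp add: xp)
  moreover have "adj G x (p ! (length p - 1))"
    using e[of "length p"] \<open>p \<noteq> []\<close> by (simp add: xp nth_Cons' adj_sym)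
  moreover have "p ! 0 \<noteq> p ! (length p - 1)"
    using nth_eq_iff_index_eq[OF dist(1), of 0 "length p - 1"] len \<open>p \<noteq> []\<close> by simp
  moreover have "p ! 0 \<in> set p" "p ! (length p - 1) \<in> set p"
    using len by (auto intro!: nth_mem)
  moreover have "set p \<subseteq> verts G"
  proof
    fix y assume "y \<in> set p"
    then obtain i where "i < length p" "p ! i = y" by (auto simp: in_set_conv_nth)
    with e[of "Suc i"] have "adj G y (c ! (Suc (Suc i) mod length c))" by (simp add: xp)
    then show "y \<in> verts G" by (rule adj_simple(2)[OF G])
  qed
  ultimately have "attached_twice G x (set p)"
    using dist(2) by (auto simp: attached_twice_def)
  with that xp show ?thesis by simp
qed

lemma conn_attached_twice:
  assumes G: "simple_graph G" and D: "conn G D" "D \<subseteq> verts G" "u \<notin> D"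
    and ab: "a \<in> D" "b \<in> D" "a \<noteq> b" "adj G u a" "adj G u b"
  obtains T where "attached_twice G u T" "T \<subseteq> D"
proof -
  have simple: "simple_graph (induced G D)" using G by (auto simp: simple_graph_def induced_def)
  have c: "connected_graph (induced G D)" using D(1) by (simp add: conn_def)
  have sub: "finite {b}" "{b} \<subseteq> verts (induced G D)" "a \<in> verts (induced G D)" using ab by auto
  obtain T E where T: "finite T" "insert a {b} \<subseteq> T" "T \<subseteq> verts (induced G D)"
    "E \<subseteq> edges (induced G D)" "E \<subseteq> Pow T" "connected_graph (Graph T E)" "card T \<le> card E + 1"
    by (rule finite_connected_subgraph[OF c sub simple])
  have "conn G T"
    by (rule connected_graph_mono[OF T(6)]) (use T in \<open>auto simp: induced_def\<close>)
  moreover have TD: "T \<subseteq> D" using T(3) by simp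
  ultimately have "attached_twice G u T"
    using T(1,2) D(2,3) ab(3-5) unfolding attached_twice_def by blast
  then show ?thesis using TD by (rule that)
qed

text \<open>A finite set that meets every cycle is enlarged so that no vertex of it has two neighbours
  in a component outside. The added vertices satisfy this as well: such a vertex together with its
  component would contain a cycle avoiding the original set.\<close>

lemma finite_separator:
  assumes G: "simple_graph G" and omega: "\<not> is_minor omega_K3 G" and wedge: "\<not> is_minor wedge_K3 G"
  obtains U where "finite U" "\<forall>c. is_cycle G c \<longrightarrow> set c \<inter> U \<noteq> {}"
    "\<forall>D u a b. conn G D \<longrightarrow> D \<subseteq> verts G - U \<longrightarrow> u \<in> U \<longrightarrow> a \<in> D \<longrightarrow> b \<in> D \<longrightarrow>
      adj G u a \<longrightarrow> adj G u b \<longrightarrow> a = b"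
proof -
  have "\<exists>X. finite X \<and> (\<forall>x T. attached_twice G x T \<longrightarrow> insert x T \<inter> X \<noteq> {})"
  proof (rule ccontr)
    assume "\<not> ?thesis"
    then have "\<exists>x T. attached_twice G x T \<and> insert x T \<inter> X = {}" if "finite X" for X
      using that by metis
    then show False using omega_K3_minor[OF G] omega by metis
  qed
  then obtain X where X: "finite X" "\<And>x T. attached_twice G x T \<Longrightarrow> insert x T \<inter> X \<noteq> {}" by blast
  have "\<exists>Y. finite Y \<and> (\<forall>T. attached_twice G x T \<longrightarrow> T \<inter> Y \<noteq> {})" for x
  proof (rule ccontr)
    assume "\<not> ?thesis"
    then have "\<exists>T. attached_twice G x T \<and> T \<inter> Y = {}" if "finite Y" for Y
      using that by metis
    then show False using wedge_K3_minor[OF G, of x] wedge by metis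
  qed
  then have "\<exists>Y. \<forall>x. finite (Y x) \<and> (\<forall>T. attached_twice G x T \<longrightarrow> T \<inter> Y x \<noteq> {})"
    by (intro choice allI)
  then obtain Y where Y: "\<And>x. finite (Y x)" "\<And>x T. attached_twice G x T \<Longrightarrow> T \<inter> Y x \<noteq> {}"
    by blast
  define U where "U = X \<union> (\<Union>x\<in>X. Y x)"
  show ?thesis
  proof (rule that[of U]; (intro allI impI)?)
    show "finite U" using X(1) Y(1) by (simp add: U_def)
    show "set c \<inter> U \<noteq> {}" if c: "is_cycle G c" for c
    proof -
      obtain x T where "attached_twice G x T" "insert x T = set c"
        by (rule cycle_attached_twice[OF G c])
      then have "set c \<inter> X \<noteq> {}" using X(2) by metis
      then show ?thesis by (auto simp: U_def)
    qed
    fix D u a b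
    assume D: "conn G D" "D \<subseteq> verts G - U" and u: "u \<in> U" and ab: "a \<in> D" "b \<in> D"
      "adj G u a" "adj G u b"
    show "a = b"
    proof (rule ccontr)
      assume "a \<noteq> b"
      then obtain T where T: "attached_twice G u T" "T \<subseteq> D"
        using conn_attached_twice[OF G D(1) _ _ ab(1,2) _ ab(3,4)] D(2) u by (metis DiffD1 DiffD2 subsetD subsetI)
      show False
      proof (cases "u \<in> X")
        case True
        then have "Y u \<subseteq> U" by (auto simp: U_def)
        then show False using Y(2)[OF T(1)] T(2) D(2) by blast
      next
        case False
        then show False using X(2)[OF T(1)] T(2) D(2) by (auto simp: U_def)
      qed
    qed
  qed
qed

text \<open>With a set \<open>U\<close> as just constructed, only finitely many components of \<open>G - U\<close> see two
  vertices of \<open>U\<close>. The removed edges \<open>F\<close> are those inside \<open>U\<close> and those between \<open>U\<close> and such a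
  component. A cycle that avoids \<open>F\<close> meets \<open>U\<close>, has a vertex in some component, and crosses the
  boundary of this component twice; but the component has at most one edge to \<open>U\<close> left.\<close>

lemma no_excluded_minor_forests_E:
  assumes G: "simple_graph G" and cnt: "countable (verts G)"
    and omega: "\<not> is_minor omega_K3 G" and wedge: "\<not> is_minor wedge_K3 G"
    and K2: "\<not> is_minor K2_omega G"
  shows "G \<in> forests_E"
proof -
  obtain U where U: "finite U" "\<forall>c. is_cycle G c \<longrightarrow> set c \<inter> U \<noteq> {}"
    "\<forall>D u a b. conn G D \<longrightarrow> D \<subseteq> verts G - U \<longrightarrow> u \<in> U \<longrightarrow> a \<in> D \<longrightarrow> b \<in> D \<longrightarrow>
      adj G u a \<longrightarrow> adj G u b \<longrightarrow> a = b"
    by (rule finite_separator[OF G omega wedge])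
  let ?W = "verts G - U"
  define comps where "comps = component G ?W ` ?W"
  have comps: "conn G D" "D \<subseteq> ?W" if "D \<in> comps" for D
    using that component_subset[of _ ?W G] by (auto simp: comps_def conn_component)
  define sees where "sees = (\<lambda>u v. {D \<in> comps. (\<exists>a\<in>D. adj G u a) \<and> (\<exists>b\<in>D. adj G v b)})"
  have fin_sees: "finite (sees u v)" if "u \<in> U" "v \<in> U" "u \<noteq> v" for u v
  proof (rule ccontr)
    assume inf: "infinite (sees u v)"
    have "is_minor K2_omega G"
    proof (rule K2_omega_minor[OF G inf])
      fix C D assume CD: "C \<in> sees u v" "D \<in> sees u v" "C \<noteq> D"
      obtain a where a: "C = component G ?W a" using CD(1) unfolding sees_def comps_def by blast
      obtain b where b: "D = component G ?W b" using CD(2) unfolding sees_def comps_def by blast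
      show "C \<inter> D = {}"
        using CD(3) component_eq[of _ G ?W a b] a b by (metis disjoint_iff)
    next
      fix D assume D: "D \<in> sees u v"
      then have "D \<in> comps" by (simp add: sees_def)
      from comps[OF this] that(1,2) show "D \<subseteq> verts G \<and> conn G D \<and> u \<notin> D \<and> v \<notin> D" by blast
      show "(\<exists>a\<in>D. adj G u a) \<and> (\<exists>b\<in>D. adj G v b)" using D by (simp add: sees_def)
    qed (rule that(3))
    with K2 show False by blast
  qed
  define F where "F = {e \<in> edges G. e \<subseteq> U} \<union>
    (\<Union>u\<in>U. \<Union>v\<in>U - {u}. \<Union>D\<in>sees u v. {{u, a} |a. a \<in> D \<and> adj G u a})"
  have "finite {{u, a} |a. a \<in> D \<and> adj G u a}" if "D \<in> sees u v" "u \<in> U" for u v D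
  proof -
    have D: "D \<in> comps" using that by (auto simp: sees_def)
    then have "\<exists>a0. {a \<in> D. adj G u a} \<subseteq> {a0}"
      using U(3)[rule_format, OF comps(1,2)[OF D] \<open>u \<in> U\<close>] by blast
    then have "finite {a \<in> D. adj G u a}" by (auto intro: finite_subset)
    then show ?thesis by simp
  qed
  then have finF: "finite F"
    using U(1) fin_sees unfolding F_def
    by (auto intro!: finite_UN_I finite_subset[of "{e \<in> edges G. e \<subseteq> U}" "Pow U"])
  have FG: "F \<subseteq> edges G" by (auto simp: F_def adj_def)
  let ?G = "remove_edges G F"
  have adjG: "adj ?G x y \<longleftrightarrow> adj G x y \<and> {x, y} \<notin> F" for x y
    by (simp add: adj_def remove_edges_def)
  have "\<not> is_cycle ?G c" for c
  proof
    assume c: "is_cycle ?G c"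
    then have "is_cycle G c" by (rule is_cycle_mono) (auto simp: remove_edges_def)
    then obtain b where b: "b \<in> set c" "b \<in> U" using U(2) by blast
    have c01: "adj ?G (c ! 0) (c ! 1)" "c ! 0 \<in> set c" "c ! 1 \<in> set c"
    proof -
      have len: "3 \<le> length c" using c by (simp add: is_cycle_def)
      then have "0 < length c" "Suc 0 mod length c = 1" by auto
      moreover have "\<forall>i<length c. adj ?G (c ! i) (c ! (Suc i mod length c))"
        using c by (simp add: is_cycle_def)
      ultimately show "adj ?G (c ! 0) (c ! 1)" by metis
      show "c ! 0 \<in> set c" "c ! 1 \<in> set c" using len by (auto intro!: nth_mem)
    qed
    have "\<not> (c ! 0 \<in> U \<and> c ! 1 \<in> U)" using c01(1) unfolding adjG unfolding adj_def F_def by blast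
    moreover have "c ! 0 \<in> verts G" "c ! 1 \<in> verts G"
      using c01(1) adj_simple[OF G] by (auto simp: adjG)
    ultimately obtain a where a: "a \<in> set c" "a \<in> ?W" using c01(2,3) by blast
    let ?D = "component G ?W a"
    have D: "?D \<in> comps" using a by (auto simp: comps_def)
    have bD: "b \<notin> ?D" using b comps[OF D] by blast
    obtain p q p' q' where pq: "adj ?G p q" "adj ?G p' q'" "{p, q} \<noteq> {p', q'}"
      "p \<in> ?D" "q \<notin> ?D" "p' \<in> ?D" "q' \<notin> ?D"
      by (rule cycle_crosses_twice[OF c a(1) component_self b(1) bD])
    have leave: "z \<in> U" if "adj ?G y z" "y \<in> ?D" "z \<notin> ?D" for y z
    proof (rule ccontr)
      assume "z \<notin> U"
      have "adj G y z" using that(1) by (simp add: adjG)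
      then have "z \<in> ?W" "y \<in> ?W"
        using \<open>z \<notin> U\<close> that(2) comps(2)[OF D] adj_simple(3)[OF G] by blast+
      then have "z \<in> ?D" using component_closed[OF that(2) \<open>adj G y z\<close>] by blast
      with that(3) show False by simp
    qed
    have qU: "q \<in> U" "q' \<in> U" by (rule leave[OF pq(1,4,5)], rule leave[OF pq(2,6,7)])
    have qp: "adj G q p" "adj G q' p'" using pq(1,2) by (auto simp: adjG intro: adj_sym)
    show False
    proof (cases "q = q'")
      case True
      then have "p = p'" using U(3)[rule_format, OF comps[OF D] qU(1) pq(4,6)] qp by simp
      with True pq(3) show False by simp
    next
      case False
      have "?D \<in> sees q q'" using D pq(4,6) qp by (auto simp: sees_def)
      then have "{q, p} \<in> F" using False qU pq(4) qp(1) unfolding F_def by blast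
      then show False using pq(1) by (simp add: adjG insert_commute)
    qed
  qed
  moreover have "?G \<in> countable_graphs"
    using G cnt by (auto simp: countable_graphs_def simple_graph_def remove_edges_def)
  ultimately have "?G \<in> forests" by (simp add: forests_def)
  then show ?thesis using G cnt finF FG by (auto simp: forests_E_def countable_graphs_def)
qed

theorem proposition4p3:
  "(forests_E :: 'a graph set) = Forb {omega_K3, wedge_K3, K2_omega}"
proof (intro equalityI subsetI)
  fix G :: "'a graph" assume "G \<in> forests_E"
  then obtain F where G: "G \<in> countable_graphs" "simple_graph G"
    and F: "finite F" "remove_edges G F \<in> forests"
    by (auto simp: forests_E_def countable_graphs_def)
  show "G \<in> Forb {omega_K3, wedge_K3, K2_omega}"
    using G(1) omega_K3_not_minor[OF G(2) F] wedge_K3_not_minor[OF G(2) F]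
      K2_omega_not_minor[OF G(2) F]
    by (auto simp: Forb_def)
next
  fix G :: "'a graph" assume "G \<in> Forb {omega_K3, wedge_K3, K2_omega}"
  then show "G \<in> forests_E"
    by (intro no_excluded_minor_forests_E) (auto simp: Forb_def countable_graphs_def)
qed

end
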